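(* Let $(S,\Sigma,\mu)$ be a positive measure space, let $X$ be a Banach space and let $f,g\in L^{1}(\mu,X)$. (i) If $X$ is a complex smooth Banach space, then $f\perp_{BJ}g$ in $L^{1}(\mu,X)$ if and only if $$\left|\int_{Z(f)^c}\operatorname{Re}\big(F_{f(s)}(\alpha g(s))\big)\,d\mu(s)\right|\le\int_{Z(f)}|\alpha|\,\|g(s)\|\,d\mu(s)\quad\text{for all }\alpha\in\mathbb{C}.$$ (ii) If $X$ is a real Banach space whose norm is Fréchet differentiable, then $f\perp_{BJ}g$ in $L^{1}(\mu,X)$ if and only if $$\left|\int_{Z(f)^c}F_{f(s)}(g(s))\,d\mu(s)\right|\le\int_{Z(f)}\|g(s)\|\,d\mu(s).$$
   Context: For a normed space $E$ over $\mathbb{F}$ ($\mathbb{R}$ or $\mathbb{C}$) and $u,v\in E$, $u$ is Birkhoff-James orthogonal to $v$, written $u\perp_{BJ}v$, if $\|u+\lambda v\|\ge\|u\|$ for all $\lambda\in\mathbb{F}$. $L^{1}(\mu,X)$ is the Lebesgue-Bochner space of (classes modulo a.e. equality of) strongly measurable functions $f:S\to X$ with $\|f\|_1=\int_S\|f(s)\|\,d\mu(s)<\infty$. For $0\neq x\in X$, a support map $F_x$ at $x$ is a bounded linear functional on $X$ (linear over the scalar field of $X$) with $\|F_x\|=1$ and $F_x(x)=\|x\|$; $X$ is smooth if for each $x\neq0$ the support map $F_x$ is unique. The norm of a real Banach space $X$ is Fréchet differentiable if for every $0\neq x\in X$ there is $\varphi\in X^*$ with $\lim_{h\to0}\frac{|\|x+h\|-\|x\|-\varphi(h)|}{\|h\|}=0$;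 in that case $X$ is smooth. For a function $h:S\to X$, $Z(h)=\{s\in S:h(s)=0\}$ and $Z(h)^c$ is its complement in $S$. *)

theory Defs
  imports "HOL-Analysis.Analysis" "HOL-Library.Function_Algebras"
begin

class complex_normed_vector = real_normed_vector +
  fixes scaleC :: "complex \<Rightarrow> 'a \<Rightarrow> 'a"  (infixr \<open>*\<^sub>C\<close> 75)
  assumes scaleC_add_right: "a *\<^sub>C (x + y) = a *\<^sub>C x + a *\<^sub>C y"
    and scaleC_add_left: "(a + b) *\<^sub>C x = a *\<^sub>C x + b *\<^sub>C x"
    and scaleC_scaleC: "a *\<^sub>C b *\<^sub>C x = (a * b) *\<^sub>C x"
    and scaleC_of_real: "complex_of_real r *\<^sub>C x = r *\<^sub>R x"
    and norm_scaleC: "norm (a *\<^sub>C x) = cmod a * norm x"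

class complex_banach = complex_normed_vector + banach

(* Birkhoff-James orthogonality, in the space given by the scalar multiplication scl
   and the norm nrm; the scalar field is the type 'k. *)
definition BJ_orthogonal ::
    "('k \<Rightarrow> 'e \<Rightarrow> 'e) \<Rightarrow> ('e \<Rightarrow> real) \<Rightarrow> 'e::plus \<Rightarrow> 'e \<Rightarrow> bool" where
  "BJ_orthogonal scl nrm u v \<longleftrightarrow> (\<forall>c. nrm (u + scl c v) \<ge> nrm u)"

(* The range space need not be separable, so Borel measurability would be too weak here
   (it is not even preserved by sums), and the library's Bochner integrability, restricted
   to second countable spaces, does not apply. *)
definition strongly_measurable :: "'s measure \<Rightarrow> ('s \<Rightarrow> 'x::real_normed_vector) \<Rightarrow> bool" where
  "strongly_measurable M f \<longleftrightarrow>
     (\<exists>u. (\<forall>n. simple_function M (u n)) \<and> (\<forall>s\<in>space M. (\<lambda>n. u n s) \<longlonglongrightarrow> f s))"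

(* As with the library's integrable, elements are functions, i.e. representatives of the
   classes modulo almost everywhere equality, and L1_norm is a seminorm on them. *)
definition L1 :: "'s measure \<Rightarrow> ('s \<Rightarrow> 'x::real_normed_vector) set" where
  "L1 M = {f. strongly_measurable M f \<and> integrable M (\<lambda>s. norm (f s))}"

definition L1_norm :: "'s measure \<Rightarrow> ('s \<Rightarrow> 'x::real_normed_vector) \<Rightarrow> real" where
  "L1_norm M f = (LINT s|M. norm (f s))"

definition zero_set :: "'s measure \<Rightarrow> ('s \<Rightarrow> 'x::zero) \<Rightarrow> 's set" where
  "zero_set M h = {s \<in> space M. h s = 0}"

definition is_support_map :: "'x::real_normed_vector \<Rightarrow> ('x \<Rightarrow> real) \<Rightarrow> bool" where
  "is_support_map x \<phi> \<longleftrightarrow> bounded_linear \<phi> \<and> onorm \<phi> = 1 \<and> \<phi> x = norm x"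

definition is_csupport_map :: "'x::complex_normed_vector \<Rightarrow> ('x \<Rightarrow> complex) \<Rightarrow> bool" where
  "is_csupport_map x \<phi> \<longleftrightarrow>
     bounded_linear \<phi> \<and> (\<forall>a y. \<phi> (a *\<^sub>C y) = a * \<phi> y) \<and>
     onorm \<phi> = 1 \<and> \<phi> x = complex_of_real (norm x)"

(* Unspecified at points without a unique support map, in particular at 0. *)
definition support_map :: "'x::real_normed_vector \<Rightarrow> 'x \<Rightarrow> real" where
  "support_map x = (THE \<phi>. is_support_map x \<phi>)"

definition csupport_map :: "'x::complex_normed_vector \<Rightarrow> 'x \<Rightarrow> complex" where
  "csupport_map x = (THE \<phi>. is_csupport_map x \<phi>)"

definition csmooth :: "'x::complex_normed_vector itself \<Rightarrow> bool" where
  "csmooth _ \<longleftrightarrow> (\<forall>x::'x. x \<noteq> 0 \<longrightarrow> (\<exists>!\<phi>. is_csupport_map x \<phi>))"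

(* differentiable is Frechet differentiability, with a bounded linear derivative. *)
definition Frechet_norm :: "'x::real_normed_vector itself \<Rightarrow> bool" where
  "Frechet_norm _ \<longleftrightarrow> (\<forall>x::'x. x \<noteq> 0 \<longrightarrow> norm differentiable (at x))"

end

(* The derivative of ||f + t g||_1 at t = 0 from the right is the integral of ||g|| over
   Z(f) plus the integral of the derivative of t |-> ||f(s) + t g(s)|| over the complement, by
   dominated convergence with majorant ||g||. Where f(s) is not 0, that pointwise derivative is
   Re F_{f(s)}(g(s)). Orthogonality to g over the reals means that this one-sided derivative is
   nonnegative for both g and -g (conversely by convexity, used pointwise), and orthogonality
   over the complex numbers means real orthogonality to every alpha g.

   In the Frechet differentiable case the support map is the derivative of the norm. In the
   complex smooth case the one-sided derivative of the norm at x is sublinear, and by Hahn-Banach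
   it is the pointwise maximum of the real parts of support maps at x; uniqueness of the support
   map makes it linear, so the derivative is two-sided. *)

theory Submission
  imports Defs
begin

section \<open>A Hahn-Banach theorem from minimal sublinear functionals\<close>

definition sublinear :: "('a::real_vector \<Rightarrow> real) \<Rightarrow> bool" where
  "sublinear q \<longleftrightarrow>
     (\<forall>x y. q (x + y) \<le> q x + q y) \<and> (\<forall>c x. c > 0 \<longrightarrow> q (c *\<^sub>R x) \<le> c * q x)"

text \<open>The inequality for \<open>1 / c\<close> reverses the one for \<open>c\<close>, so
  one-sided homogeneity already gives equality. Hence only inequalities have to be checked for the
  infima constructed below.\<close>

lemma sublinearD:
  assumes "sublinear q"
  shows sublinear_add: "q (x + y) \<le> q x + q y"
    and sublinear_scaleR: "0 \<le> c \<Longrightarrow> q (c *\<^sub>R x) = c * q x"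
    and sublinear_0: "q 0 = 0"
    and sublinear_minus: "- q (- x) \<le> q x"
proof -
  have le: "q (c *\<^sub>R x) \<le> c * q x" if "c > 0" for c x
    using assms that unfolding sublinear_def by blast
  show add: "q (x + y) \<le> q x + q y" for x y
    using assms unfolding sublinear_def by blast
  show z: "q 0 = 0"
    using le[of 2 0] le[of "1/2" 0] by simp
  show "q (c *\<^sub>R x) = c * q x" if "0 \<le> c"
  proof (cases "c = 0")
    case False
    with that have c: "c > 0" by simp
    have "q x \<le> (1 / c) * q (c *\<^sub>R x)"
      using le[of "1 / c" "c *\<^sub>R x"] c by simp
    with c le[OF c, of x] show ?thesis by (simp add: field_simps)
  qed (simp add: z)
  show "- q (- x) \<le> q x"
    using add[of x "- x"] z by simp
qed

text \<open>A linear functional below \<open>tilt q y\<close> agrees with \<open>q\<close> at \<open>y\<close>, because \<open>tilt q y (- y) \<le> - q y\<close>.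
  Since \<open>tilt q y \<le> q\<close>, minimality of \<open>q\<close> gives
  \<open>q x + q y \<le> q (x + y)\<close>.\<close>

definition tilt :: "('a::real_vector \<Rightarrow> real) \<Rightarrow> 'a \<Rightarrow> 'a \<Rightarrow> real" where
  "tilt q y x = (INF t\<in>{0..}. q (x + t *\<^sub>R y) - t * q y)"

text \<open>All terms of the infimum are at least \<open>- q (- x)\<close>, so it is finite. Terms
  with parameters \<open>t1\<close> and \<open>t2\<close> combine into the term with
  \<open>t1 + t2\<close>, which gives subadditivity; replacing \<open>t\<close> by
  \<open>c * t\<close> gives homogeneity.\<close>

lemma tilt:
  assumes q: "sublinear q"
  shows sublinear_tilt: "sublinear (tilt q y)"
    and tilt_le: "0 \<le> t \<Longrightarrow> tilt q y x \<le> q (x + t *\<^sub>R y) - t * q y"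
proof -
  let ?r = "tilt q y"
  have below: "- q (- x) \<le> q (x + t *\<^sub>R y) - t * q y" if "0 \<le> t" for x t
    using sublinear_add[OF q, of "x + t *\<^sub>R y" "- x"] sublinear_scaleR[OF q that, of y]
    by (simp add: algebra_simps)
  have bdd: "bdd_below ((\<lambda>t. q (x + t *\<^sub>R y) - t * q y) ` {0..})" for x
    by (rule bdd_belowI[of _ "- q (- x)"]) (use below in auto)
  show le: "?r x \<le> q (x + t *\<^sub>R y) - t * q y" if "0 \<le> t" for x t
    unfolding tilt_def by (rule cINF_lower[OF bdd]) (use that in auto)
  have ge: "c \<le> ?r x" if "\<And>t. 0 \<le> t \<Longrightarrow> c \<le> q (x + t *\<^sub>R y) - t * q y" for c x
    unfolding tilt_def by (rule cINF_greatest) (use that in auto)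
  show "sublinear ?r"
    unfolding sublinear_def
  proof (intro conjI allI impI)
    fix x1 x2
    have *: "?r (x1 + x2) \<le> (q (x1 + t1 *\<^sub>R y) - t1 * q y) + (q (x2 + t2 *\<^sub>R y) - t2 * q y)"
      if "0 \<le> t1" "0 \<le> t2" for t1 t2
      using le[of "t1 + t2" "x1 + x2"] that
        sublinear_add[OF q, of "x1 + t1 *\<^sub>R y" "x2 + t2 *\<^sub>R y"]
      by (simp add: algebra_simps)
    have "?r (x1 + x2) - (q (x2 + t2 *\<^sub>R y) - t2 * q y) \<le> ?r x1" if "0 \<le> t2" for t2
      by (rule ge) (use *[OF _ that] in \<open>simp add: algebra_simps\<close>)
    then have "?r (x1 + x2) - ?r x1 \<le> ?r x2"
      by (intro ge) (simp add: algebra_simps)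
    then show "?r (x1 + x2) \<le> ?r x1 + ?r x2" by simp
  next
    fix c :: real and x assume c: "c > 0"
    have "?r (c *\<^sub>R x) / c \<le> q (x + t *\<^sub>R y) - t * q y" if "0 \<le> t" for t
    proof -
      have "?r (c *\<^sub>R x) \<le> q (c *\<^sub>R x + (c * t) *\<^sub>R y) - (c * t) * q y"
        using c that by (intro le) simp
      also have "q (c *\<^sub>R x + (c * t) *\<^sub>R y) = c * q (x + t *\<^sub>R y)"
        using sublinear_scaleR[OF q, of c "x + t *\<^sub>R y"] c by (simp add: scaleR_add_right)
      finally show ?thesis using c by (simp add: field_simps)
    qed
    then have "?r (c *\<^sub>R x) / c \<le> ?r x" by (rule ge)
    with c show "?r (c *\<^sub>R x) \<le> c * ?r x" by (simp add: field_simps)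
  qed
qed

text \<open>Minimality forces \<open>tilt q y = q\<close> for every \<open>y\<close>, which makes
  \<open>q\<close> additive. Additivity makes \<open>q\<close> odd, and this extends homogeneity to
  negative scalars.\<close>

lemma minimal_sublinear_linear:
  assumes q: "sublinear q" and min: "\<And>r. sublinear r \<Longrightarrow> (\<And>x. r x \<le> q x) \<Longrightarrow> r = q"
  shows "linear q"
proof -
  have add: "q (x + y) = q x + q y" for x y
  proof -
    have "tilt q y = q"
      by (rule min[OF sublinear_tilt[OF q]]) (use tilt_le[OF q, of 0] in simp)
    with tilt_le[OF q, of 1 y x] have "q x + q y \<le> q (x + y)" by simp
    with sublinear_add[OF q, of x y] show ?thesis by simp
  qed
  have minus: "q (- x) = - q x" for x
    using add[of x "- x"] sublinear_0[OF q] by simp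
  show ?thesis
  proof (rule linearI)
    show "q (c *\<^sub>R x) = c *\<^sub>R q x" for c x
    proof (cases "0 \<le> c")
      case False
      then show ?thesis
        using sublinear_scaleR[OF q, of "- c" x] minus[of "c *\<^sub>R x"] by simp
    qed (simp add: sublinear_scaleR[OF q])
  qed (rule add)
qed

text \<open>Zorn's lemma yields a minimal sublinear functional below \<open>p\<close>. The lower
  bound of a nonempty chain is its pointwise infimum, finite because every member \<open>q\<close>
  satisfies \<open>- p (- x) \<le> q x\<close>.\<close>

lemma ex_linear_le_sublinear:
  assumes p: "sublinear p"
  obtains \<phi> where "linear \<phi>" "\<And>x. \<phi> x \<le> p x"
proof -
  define A where "A = {q. sublinear q \<and> q \<le> p}"
  \<comment> \<open>The order is reversed, so that a maximal element for \<open>?R\<close> is a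
    minimal functional.\<close>
  let ?R = "relation_of (\<lambda>a b. b \<le> a) A"
  have po: "partial_order_on A ?R"
    by (rule partial_order_on_relation_ofI) auto
  have "\<exists>u\<in>A. \<forall>a\<in>C. u \<le> a" if C: "C \<in> Chains ?R" for C
  proof (cases "C = {}")
    case True
    then show ?thesis using p by (auto simp: A_def)
  next
    case False
    have CA: "C \<subseteq> A" and chain: "\<And>a b. a \<in> C \<Longrightarrow> b \<in> C \<Longrightarrow> a \<le> b \<or> b \<le> a"
      using C by (auto simp: Chains_def relation_of_def)
    have sub: "sublinear q" and qp: "q x \<le> p x" if "q \<in> C" for q x
      using CA that by (auto simp: A_def le_fun_def)
    define u where "u = (\<lambda>x. INF q\<in>C. q x)"
    have "- p (- x) \<le> q x" if "q \<in> C" for q x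
      using sublinear_minus[OF sub[OF that], of x] qp[OF that, of "- x"] by simp
    then have "bdd_below ((\<lambda>q. q x) ` C)" for x
      by (intro bdd_belowI[of _ "- p (- x)"]) auto
    then have le: "u x \<le> q x" if "q \<in> C" for q x
      unfolding u_def using that by (rule cINF_lower)
    have ge: "c \<le> u x" if "\<And>q. q \<in> C \<Longrightarrow> c \<le> q x" for c x
      unfolding u_def using False that by (rule cINF_greatest)
    have "sublinear u"
      unfolding sublinear_def
    proof (intro conjI allI impI)
      fix x y
      \<comment> \<open>An infimum of sublinear functionals need not be subadditive; here the
        smaller of \<open>q1\<close> and \<open>q2\<close> lies in the chain and serves both
        arguments at once.\<close>
      have *: "u (x + y) \<le> q1 x + q2 y" if q12: "q1 \<in> C" "q2 \<in> C" for q1 q2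
      proof -
        obtain q where q: "q \<in> C" "q \<le> q1" "q \<le> q2"
          using chain[OF q12] q12 by auto
        have "u (x + y) \<le> q (x + y)" using q by (intro le)
        also have "\<dots> \<le> q x + q y" by (rule sublinear_add[OF sub[OF q(1)]])
        also have "\<dots> \<le> q1 x + q2 y" using q by (intro add_mono) (auto simp: le_fun_def)
        finally show ?thesis .
      qed
      have "u (x + y) - q2 y \<le> u x" if "q2 \<in> C" for q2
        by (rule ge) (use *[OF _ that] in \<open>simp add: algebra_simps\<close>)
      then have "u (x + y) - u x \<le> u y"
        by (intro ge) (simp add: algebra_simps)
      then show "u (x + y) \<le> u x + u y" by simp
    next
      fix c :: real and x assume c: "c > 0"
      have "u (c *\<^sub>R x) / c \<le> q x" if "q \<in> C" for q
        using le[OF that, of "c *\<^sub>R x"] sublinear_scaleR[OF sub[OF that], of c x] c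
        by (simp add: field_simps)
      then have "u (c *\<^sub>R x) / c \<le> u x" by (rule ge)
      with c show "u (c *\<^sub>R x) \<le> c * u x" by (simp add: field_simps)
    qed
    moreover have "u \<le> p"
      using False le qp by (fastforce simp: le_fun_def intro: order_trans)
    ultimately show ?thesis
      using le by (auto simp: A_def le_fun_def)
  qed
  then obtain q where q: "q \<in> A" and min: "\<And>r. r \<in> A \<Longrightarrow> r \<le> q \<Longrightarrow> r = q"
    using predicate_Zorn[OF po] by blast
  have "linear q"
  proof (rule minimal_sublinear_linear)
    show "sublinear q" using q by (simp add: A_def)
    show "r = q" if "sublinear r" "\<And>x. r x \<le> q x" for r
      using that q by (intro min) (auto simp: A_def le_fun_def intro: order_trans)
  qed
  then show thesis
    using q by (intro that[of q]) (auto simp: A_def le_fun_def)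
qed

text \<open>Prescribing the value at \<open>y\<close> usually means extending a functional from the
  line through \<open>y\<close>. Dominating by \<open>tilt p y\<close> in place of \<open>p\<close>
  has the same effect.\<close>

lemma ex_linear_le_sublinear_eq:
  assumes p: "sublinear p"
  obtains \<phi> where "linear \<phi>" "\<And>x. \<phi> x \<le> p x" "\<phi> y = p y"
proof -
  obtain \<phi> where \<phi>: "linear \<phi>" "\<And>x. \<phi> x \<le> tilt p y x"
    using ex_linear_le_sublinear[OF sublinear_tilt[OF p]] by blast
  have le: "\<phi> x \<le> p x" for x
    using \<phi>(2)[of x] tilt_le[OF p, of 0 y x] by simp
  have "\<phi> (- y) \<le> - p y"
    using \<phi>(2)[of "- y"] tilt_le[OF p, of 1 y "- y"] sublinear_0[OF p] by simp
  then have "\<phi> y = p y"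
    using le[of y] linear_neg[OF \<phi>(1), of y] by simp
  with \<phi>(1) le show thesis by (rule that)
qed

section \<open>One-sided directional derivatives of the norm\<close>

lemma norm_quotient_mono:
  fixes x y :: "'a::real_normed_vector"
  assumes "0 < s" "s \<le> t"
  shows "(norm (x + s *\<^sub>R y) - norm x) / s \<le> (norm (x + t *\<^sub>R y) - norm x) / t"
proof -
  \<comment> \<open>The nearer point is a convex combination of \<open>x\<close> and the farther
    point, with weight \<open>s / t\<close> on the latter.\<close>
  have "x + s *\<^sub>R y = (1 - s / t) *\<^sub>R x + (s / t) *\<^sub>R (x + t *\<^sub>R y)"
    using assms by (simp add: algebra_simps)
  also have "norm \<dots> \<le> norm ((1 - s / t) *\<^sub>R x) + norm ((s / t) *\<^sub>R (x + t *\<^sub>R y))"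
    by (rule norm_triangle_ineq)
  also have "\<dots> = (1 - s / t) * norm x + (s / t) * norm (x + t *\<^sub>R y)"
    using assms by simp
  finally show ?thesis using assms by (simp add: field_simps)
qed

text \<open>The difference quotients increase with \<open>t\<close>, so their infimum is the limit
  from the right. As an infimum bounded below by \<open>- norm y\<close>, it needs no convergence
  argument.\<close>

definition norm_right_deriv :: "'a::real_normed_vector \<Rightarrow> 'a \<Rightarrow> real" where
  "norm_right_deriv x y = (INF t\<in>{0<..}. (norm (x + t *\<^sub>R y) - norm x) / t)"

lemma norm_right_deriv:
  fixes x :: "'a::real_normed_vector"
  shows sublinear_norm_right_deriv: "sublinear (norm_right_deriv x)"
    and norm_right_deriv_le:
      "0 < t \<Longrightarrow> norm_right_deriv x y \<le> (norm (x + t *\<^sub>R y) - norm x) / t"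
proof -
  let ?p = "norm_right_deriv x"
  have below: "- norm y \<le> (norm (x + t *\<^sub>R y) - norm x) / t" if "0 < t" for y t
    using norm_triangle_ineq4[of "x + t *\<^sub>R y" "t *\<^sub>R y"] that by (simp add: field_simps)
  have bdd: "bdd_below ((\<lambda>t. (norm (x + t *\<^sub>R y) - norm x) / t) ` {0<..})" for y
    by (rule bdd_belowI[of _ "- norm y"]) (use below in auto)
  show le: "?p y \<le> (norm (x + t *\<^sub>R y) - norm x) / t" if "0 < t" for y t
    unfolding norm_right_deriv_def by (rule cINF_lower[OF bdd]) (use that in auto)
  have ge: "c \<le> ?p y" if "\<And>t. 0 < t \<Longrightarrow> c \<le> (norm (x + t *\<^sub>R y) - norm x) / t" for c y
    unfolding norm_right_deriv_def by (rule cINF_greatest) (use that in auto)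
  show "sublinear ?p"
    unfolding sublinear_def
  proof (intro conjI allI impI)
    fix y1 y2
    have *: "?p (y1 + y2) \<le> (norm (x + s *\<^sub>R y1) - norm x) / s + (norm (x + t *\<^sub>R y2) - norm x) / t"
      if "0 < s" "0 < t" for s t
    proof -
      \<comment> \<open>This \<open>r\<close> solves \<open>r / s + r / t = 1\<close>, so that
        \<open>x + r *\<^sub>R (y1 + y2)\<close> is a convex combination of
        \<open>x + s *\<^sub>R y1\<close> and \<open>x + t *\<^sub>R y2\<close>. As \<open>s\<close>
        and \<open>t\<close> stay independent, the two infima can be taken one after the
        other.\<close>
      define r where "r = 1 / (1 / s + 1 / t)"
      have ir: "1 / r = 1 / s + 1 / t" by (simp add: r_def)
      have r: "0 < r" using that by (simp add: r_def add_pos_pos)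
      have "r / s + r / t = r * (1 / r)" by (simp add: ir distrib_left)
      then have sum1: "r / s + r / t = 1" using r by simp
      have "x + r *\<^sub>R (y1 + y2) = (r / s + r / t) *\<^sub>R x + r *\<^sub>R (y1 + y2)"
        by (simp add: sum1)
      also have "\<dots> = (r / s) *\<^sub>R (x + s *\<^sub>R y1) + (r / t) *\<^sub>R (x + t *\<^sub>R y2)"
        using that by (simp add: algebra_simps)
      also have "norm \<dots> \<le> norm ((r / s) *\<^sub>R (x + s *\<^sub>R y1)) + norm ((r / t) *\<^sub>R (x + t *\<^sub>R y2))"
        by (rule norm_triangle_ineq)
      also have "\<dots> = r * (norm (x + s *\<^sub>R y1) / s + norm (x + t *\<^sub>R y2) / t)"
        using that r by (simp only: norm_scaleR) (simp add: distrib_left)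
      finally have "norm (x + r *\<^sub>R (y1 + y2)) / r
          \<le> norm (x + s *\<^sub>R y1) / s + norm (x + t *\<^sub>R y2) / t"
        using r by (simp add: pos_divide_le_eq mult.commute)
      moreover have "norm x / r = norm x / s + norm x / t"
        using arg_cong[OF ir, of "\<lambda>u. norm x * u"] by (simp add: algebra_simps)
      ultimately show ?thesis
        using le[OF r, of "y1 + y2"] by (simp add: diff_divide_distrib)
    qed
    have "?p (y1 + y2) - (norm (x + t *\<^sub>R y2) - norm x) / t \<le> ?p y1" if "0 < t" for t
      by (rule ge) (use *[OF _ that] in \<open>simp add: algebra_simps\<close>)
    then have "?p (y1 + y2) - ?p y1 \<le> ?p y2"
      by (intro ge) (simp add: algebra_simps)
    then show "?p (y1 + y2) \<le> ?p y1 + ?p y2" by simp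
  next
    fix c :: real and y assume c: "c > 0"
    have "?p (c *\<^sub>R y) / c \<le> (norm (x + t *\<^sub>R y) - norm x) / t" if "0 < t" for t
      using le[of "t / c" "c *\<^sub>R y"] c that by (simp add: field_simps)
    then have "?p (c *\<^sub>R y) / c \<le> ?p y" by (rule ge)
    with c show "?p (c *\<^sub>R y) \<le> c * ?p y" by (simp add: field_simps)
  qed
qed

text \<open>The infimum supplies a single \<open>d\<close> with a quotient below the bound, and
  monotonicity of the quotients carries the bound to all smaller \<open>t\<close>.\<close>

lemma norm_quotient_near_right_deriv:
  fixes x y :: "'a::real_normed_vector"
  assumes "0 < e"
  obtains d where "0 < d" "\<And>t. 0 < t \<Longrightarrow> t \<le> d \<Longrightarrow>
    (norm (x + t *\<^sub>R y) - norm x) / t < norm_right_deriv x y + e"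
proof -
  let ?Q = "\<lambda>t. (norm (x + t *\<^sub>R y) - norm x) / t"
  have "\<exists>d\<in>{0<..}. ?Q d < norm_right_deriv x y + e"
  proof (rule ccontr)
    assume "\<not> ?thesis"
    then have "norm_right_deriv x y + e \<le> (INF t\<in>{0<..}. ?Q t)"
      by (intro cINF_greatest) (auto simp: not_less)
    with assms show False by (simp add: norm_right_deriv_def)
  qed
  then obtain d where d: "0 < d" "?Q d < norm_right_deriv x y + e" by auto
  show thesis
    by (rule that[OF d(1)]) (use norm_quotient_mono[of _ d x y] d in force)
qed

text \<open>A quotient along \<open>y\<close> at negative \<open>t\<close> is minus the quotient
  along \<open>- y\<close> at \<open>- t\<close>. The hypothesis therefore says that the left and
  right derivatives coincide.\<close>

lemma has_real_derivative_norm_line: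
  fixes x y :: "'a::real_normed_vector"
  assumes neg: "norm_right_deriv x (- y) = - norm_right_deriv x y"
  shows "((\<lambda>t. norm (x + t *\<^sub>R y)) has_real_derivative norm_right_deriv x y) (at 0)"
proof -
  let ?p = "norm_right_deriv x"
  let ?Q = "\<lambda>v t. (norm (x + t *\<^sub>R v) - norm x) / t"
  have "((\<lambda>t. ?Q y t) \<longlongrightarrow> ?p y) (at 0)"
    unfolding LIM_def
  proof (intro allI impI)
    fix e :: real assume e: "0 < e"
    obtain d1 where d1: "0 < d1" "\<And>t. 0 < t \<Longrightarrow> t \<le> d1 \<Longrightarrow> ?Q y t < ?p y + e"
      using norm_quotient_near_right_deriv[OF e, of x y] by blast
    obtain d2 where d2: "0 < d2" "\<And>t. 0 < t \<Longrightarrow> t \<le> d2 \<Longrightarrow> ?Q (- y) t < ?p (- y) + e"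
      using norm_quotient_near_right_deriv[OF e, of x "- y"] by blast
    have "dist (?Q y t) (?p y) < e" if t: "t \<noteq> 0" "dist t 0 < min d1 d2" for t
    proof (cases "0 < t")
      case True
      then show ?thesis using d1(2)[of t] norm_right_deriv_le[of t x y] t by (simp add: dist_real_def)
    next
      case False
      have "?Q y t = - ?Q (- y) (- t)" using t(1) by (simp add: field_simps)
      then show ?thesis
        using d2(2)[of "- t"] norm_right_deriv_le[of "- t" x "- y"] t False neg by (simp add: dist_real_def)
    qed
    then show "\<exists>s>0. \<forall>t. t \<noteq> 0 \<and> dist t 0 < s \<longrightarrow> dist (?Q y t) (?p y) < e"
      using d1(1) d2(1) by (intro exI[of _ "min d1 d2"]) auto
  qed
  then show ?thesis by (simp add: has_field_derivative_iff)
qed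

text \<open>The norm along a line is convex, and a convex function lies above its tangent. This
  turns a derivative at 0 into an estimate for every \<open>t\<close>, which can be
  integrated.\<close>

lemma has_real_derivative_norm_line_above_tangent:
  fixes x y :: "'a::real_normed_vector"
  assumes "((\<lambda>t. norm (x + t *\<^sub>R y)) has_real_derivative D) (at 0)"
  shows "norm x + t * D \<le> norm (x + t *\<^sub>R y)"
proof -
  have "convex_on UNIV (\<lambda>t. norm (x + t *\<^sub>R y))"
  proof (rule convex_onI)
    fix u s t :: real assume u: "0 < u" "u < 1"
    have "x + ((1 - u) *\<^sub>R s + u *\<^sub>R t) *\<^sub>R y
        = (1 - u) *\<^sub>R (x + s *\<^sub>R y) + u *\<^sub>R (x + t *\<^sub>R y)"
      by (simp add: algebra_simps)
    then show "norm (x + ((1 - u) *\<^sub>R s + u *\<^sub>R t) *\<^sub>R y)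
        \<le> (1 - u) * norm (x + s *\<^sub>R y) + u * norm (x + t *\<^sub>R y)"
      using norm_triangle_ineq[of "(1 - u) *\<^sub>R (x + s *\<^sub>R y)" "u *\<^sub>R (x + t *\<^sub>R y)"] u
      by simp
  qed simp
  from convex_on_imp_above_tangent[OF this, of 0 t D] assms show ?thesis
    by (simp add: algebra_simps)
qed


section \<open>Support maps as derivatives of the norm\<close>

lemma norm_differentiable_imp_support_map:
  fixes x :: "'a::real_normed_vector"
  assumes "x \<noteq> 0" and "norm differentiable (at x)"
  shows "((\<lambda>t. norm (x + t *\<^sub>R y)) has_real_derivative support_map x y) (at 0)"
proof -
  from assms(2) obtain D where D: "(norm has_derivative D) (at x)"
    unfolding differentiable_def by blast
  have bl: "bounded_linear D" using D by (rule has_derivative_bounded_linear)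
  have deriv: "((\<lambda>t. norm (x + t *\<^sub>R y)) has_real_derivative D y) (at 0)" for y
  proof -
    have "((\<lambda>t. x + t *\<^sub>R y) has_derivative (\<lambda>t. t *\<^sub>R y)) (at 0)"
      by (auto intro!: derivative_eq_intros)
    moreover have "(norm has_derivative D) (at (x + 0 *\<^sub>R y))" using D by simp
    ultimately have "((\<lambda>t. norm (x + t *\<^sub>R y)) has_derivative (\<lambda>t. D (t *\<^sub>R y))) (at 0)"
      by (rule has_derivative_compose)
    then show ?thesis
      by (simp add: has_field_derivative_def linear_scale[OF bounded_linear.linear[OF bl]]
          mult_commute_abs)
  qed
  note tangent = has_real_derivative_norm_line_above_tangent[OF deriv]
  have le: "D y \<le> norm y" for y
    using tangent[of 1 y] norm_triangle_ineq[of x y] by simp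
  have abs_le: "\<bar>D y\<bar> \<le> norm y" for y
    using le[of y] le[of "- y"] linear_neg[OF bounded_linear.linear[OF bl], of y] by simp
  \<comment> \<open>At \<open>t = -1\<close> in direction \<open>x\<close> the tangent inequality
    reads \<open>norm x - D x \<le> 0\<close>.\<close>
  have Dx: "D x = norm x"
    using tangent[of "-1" x] le[of x] by simp
  have "onorm D = 1"
  proof (rule antisym)
    show "onorm D \<le> 1" by (rule onorm_bound) (use abs_le in auto)
    have "norm x \<le> onorm D * norm x" using onorm[OF bl, of x] Dx by simp
    then show "1 \<le> onorm D" using assms(1) by simp
  qed
  with bl Dx have "is_support_map x D" by (simp add: is_support_map_def)
  moreover have "\<phi> = D" if \<phi>: "is_support_map x \<phi>" for \<phi>
  proof
    fix y
    have bl\<phi>: "bounded_linear \<phi>" and \<phi>x: "\<phi> x = norm x" and on: "onorm \<phi> = 1"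
      using \<phi> by (auto simp: is_support_map_def)
    \<comment> \<open>Since \<phi> is dominated by the norm, with equality at \<open>x\<close>, the
      norm minus \<phi> along the line has a minimum at 0, so its derivative
      \<open>D y - \<phi> y\<close> vanishes there. This gives the uniqueness that the description
      in \<open>support_map\<close> requires.\<close>
    have "norm (x + 0 *\<^sub>R y) - 0 * \<phi> y \<le> norm (x + t *\<^sub>R y) - t * \<phi> y" for t
      using onorm[OF bl\<phi>, of "x + t *\<^sub>R y"] on \<phi>x
      by (simp add: linear_add[OF bounded_linear.linear[OF bl\<phi>]]
          linear_scale[OF bounded_linear.linear[OF bl\<phi>]])
    moreover have "((\<lambda>t. norm (x + t *\<^sub>R y) - t * \<phi> y) has_real_derivative D y - \<phi> y) (at 0)"
      by (auto intro!: derivative_eq_intros deriv)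
    ultimately have "D y - \<phi> y = 0"
      by (intro DERIV_local_min[where d = 1]) auto
    then show "\<phi> y = D y" by simp
  qed
  ultimately have "support_map x = D"
    unfolding support_map_def by (rule the_equality)
  with deriv show ?thesis by simp
qed

lemma scaleC_scaleR: "a *\<^sub>C (r *\<^sub>R x) = r *\<^sub>R (a *\<^sub>C x)" for x :: "'a::complex_normed_vector"
  by (metis mult.commute scaleC_of_real scaleC_scaleC)

text \<open>A complex linear functional is determined by its real part through
  \<open>Im (F y) = - Re (F (\<i> *\<^sub>C y))\<close>. Complexifying a dominated real functional
  this way keeps the bound by the norm.\<close>

lemma complex_linear_extension_is_csupport_map:
  fixes x :: "'a::complex_normed_vector"
  assumes x: "x \<noteq> 0" and lin: "linear \<phi>" and le: "\<And>y. \<phi> y \<le> norm y" and \<phi>x: "\<phi> x = norm x"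
  shows "is_csupport_map x (\<lambda>y. Complex (\<phi> y) (- \<phi> (\<i> *\<^sub>C y)))"
proof -
  define F where "F = (\<lambda>y. Complex (\<phi> y) (- \<phi> (\<i> *\<^sub>C y)))"
  have add: "F (y + z) = F y + F z" for y z
    by (simp add: F_def scaleC_add_right linear_add[OF lin] complex_eq_iff)
  have scaleC: "F (a *\<^sub>C y) = a * F y" for a y
  proof -
    have 1: "a *\<^sub>C y = Re a *\<^sub>R y + Im a *\<^sub>R (\<i> *\<^sub>C y)"
      by (subst complex_eq[of a])
         (simp only: scaleC_add_left scaleC_of_real scaleC_scaleC[symmetric] scaleC_scaleR mult.commute[of \<i>])
    have 2: "\<i> *\<^sub>C \<i> *\<^sub>C y = - y"
      using scaleC_of_real[of "-1" y] by (simp add: scaleC_scaleC)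
    show ?thesis
      by (simp add: F_def 1 scaleC_add_right scaleC_scaleR 2 linear_add[OF lin]
          linear_scale[OF lin] linear_diff[OF lin] complex_eq_iff)
  qed
  have norm_le: "cmod (F y) \<le> norm y" for y
  proof (cases "F y = 0")
    case False
    \<comment> \<open>Multiplication by the unimodular \<open>a\<close> rotates \<open>F y\<close>
      onto the positive real axis, where \<open>F\<close> agrees with its real part \<phi>.\<close>
    define a where "a = cnj (F y) / cmod (F y)"
    have "F (a *\<^sub>C y) = cmod (F y)"
      using False complex_norm_square[of "F y"]
      by (simp add: scaleC a_def field_simps power2_eq_square)
    then have "cmod (F y) = \<phi> (a *\<^sub>C y)"
      by (simp add: F_def complex_eq_iff)
    also have "\<dots> \<le> cmod a * norm y" using le[of "a *\<^sub>C y"] by (simp add: norm_scaleC)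
    also have "cmod a = 1" using False by (simp add: a_def norm_divide)
    finally show ?thesis by simp
  qed simp
  have bl: "bounded_linear F"
  proof (rule bounded_linear_intro[where K = 1])
    show "F (r *\<^sub>R y) = r *\<^sub>R F y" for r y
      using scaleC[of "of_real r" y] by (simp add: scaleC_of_real scaleR_conv_of_real)
  qed (use add norm_le in auto)
  \<comment> \<open>The real part of \<open>F x\<close> already exhausts the bound
    \<open>norm x\<close> on its modulus, so the imaginary part is zero.\<close>
  have Fx: "F x = complex_of_real (norm x)"
  proof -
    have "(norm x)\<^sup>2 + (Im (F x))\<^sup>2 = (cmod (F x))\<^sup>2"
      by (simp add: cmod_power2 F_def \<phi>x)
    also have "\<dots> \<le> (norm x)\<^sup>2" by (rule power_mono[OF norm_le]) simp
    finally have "(Im (F x))\<^sup>2 \<le> 0" by linarith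
    then have "Im (F x) = 0" by simp
    then show ?thesis by (simp add: complex_eq_iff) (simp add: F_def \<phi>x)
  qed
  have "onorm F = 1"
  proof (rule antisym)
    show "onorm F \<le> 1" by (rule onorm_bound) (use norm_le in auto)
    have "norm x \<le> onorm F * norm x" using onorm[OF bl, of x] Fx by simp
    then show "1 \<le> onorm F" using x by simp
  qed
  with bl scaleC Fx show ?thesis unfolding F_def[symmetric] is_csupport_map_def by blast
qed

text \<open>Any linear functional below the one-sided derivative is the real part of a support map.
  Smoothness leaves only one candidate, so the one-sided derivative is itself linear, in particular
  odd.\<close>

lemma csmooth_imp_csupport_map:
  fixes x y :: "'a::complex_normed_vector"
  assumes smooth: "csmooth TYPE('a)" and x: "x \<noteq> 0"
  shows "((\<lambda>t. norm (x + t *\<^sub>R y)) has_real_derivative Re (csupport_map x y)) (at 0)"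
proof -
  let ?p = "norm_right_deriv x"
  have ex1: "\<exists>!\<psi>. is_csupport_map x \<psi>"
    using smooth x by (simp add: csmooth_def)
  have F: "is_csupport_map x (csupport_map x)"
    unfolding csupport_map_def by (rule theI'[OF ex1])
  have p_le: "?p v \<le> norm v" for v
    using norm_right_deriv_le[of 1 x v] norm_triangle_ineq[of x v] by simp
  \<comment> \<open>The step \<open>t = 1\<close> in direction \<open>- x\<close> ends at the
    origin. The resulting bound forces \<open>\<phi> x \<ge> norm x\<close> for every linear \<phi>
    below \<open>?p\<close>.\<close>
  have px: "?p (- x) \<le> - norm x"
    using norm_right_deriv_le[of 1 x "- x"] by simp
  have p_eq: "?p v = Re (csupport_map x v)" for v
  proof -
    \<comment> \<open>This \<phi> is chosen for the given \<open>v\<close>, but its complexification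
      is the same support map for every \<open>v\<close>.\<close>
    obtain \<phi> where \<phi>: "linear \<phi>" "\<And>y. \<phi> y \<le> ?p y" "\<phi> v = ?p v"
      using ex_linear_le_sublinear_eq[OF sublinear_norm_right_deriv] by blast
    have le: "\<phi> y \<le> norm y" for y
      using \<phi>(2)[of y] p_le[of y] by simp
    have "norm x \<le> \<phi> x"
      using \<phi>(2)[of "- x"] px linear_neg[OF \<phi>(1), of x] by simp
    with le[of x] have "\<phi> x = norm x" by simp
    from complex_linear_extension_is_csupport_map[OF x \<phi>(1) le this]
    have "csupport_map x = (\<lambda>y. Complex (\<phi> y) (- \<phi> (\<i> *\<^sub>C y)))"
      using ex1 F by blast
    with \<phi>(3) show ?thesis by simp
  qed
  have "linear (csupport_map x)"
    using F by (auto simp: is_csupport_map_def intro: bounded_linear.linear)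
  then have "Re (csupport_map x (- y)) = - Re (csupport_map x y)"
    by (simp add: linear_neg)
  then have "?p (- y) = - ?p y" by (simp add: p_eq)
  then show ?thesis
    using has_real_derivative_norm_line[of x y] by (simp add: p_eq)
qed

section \<open>Strong measurability and closure properties of \<open>L1\<close>\<close>

lemma borel_measurable_norm_strongly_measurable:
  assumes "strongly_measurable M f"
  shows "(\<lambda>s. norm (f s)) \<in> borel_measurable M"
proof -
  obtain u where u: "\<And>n. simple_function M (u n)" "\<And>s. s \<in> space M \<Longrightarrow> (\<lambda>n. u n s) \<longlonglongrightarrow> f s"
    using assms by (auto simp: strongly_measurable_def)
  show ?thesis
  proof (rule borel_measurable_LIMSEQ_real)
    show "(\<lambda>n. norm (u n s)) \<longlonglongrightarrow> norm (f s)" if "s \<in> space M" for s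
      using u(2)[OF that] by (rule tendsto_norm)
    \<comment> \<open>Any function of a simple function is simple, so no Borel structure on the
      range space enters.\<close>
    show "(\<lambda>s. norm (u n s)) \<in> borel_measurable M" for n
      using simple_function_compose1[OF u(1), of norm]
      by (rule borel_measurable_simple_function)
  qed
qed

lemma strongly_measurable_add:
  assumes "strongly_measurable M f" "strongly_measurable M g"
  shows "strongly_measurable M (\<lambda>s. f s + g s)"
proof -
  obtain u where u: "\<And>n. simple_function M (u n)" "\<And>s. s \<in> space M \<Longrightarrow> (\<lambda>n. u n s) \<longlonglongrightarrow> f s"
    using assms(1) by (auto simp: strongly_measurable_def)
  obtain v where v: "\<And>n. simple_function M (v n)" "\<And>s. s \<in> space M \<Longrightarrow> (\<lambda>n. v n s) \<longlonglongrightarrow> g s"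
    using assms(2) by (auto simp: strongly_measurable_def)
  show ?thesis
    unfolding strongly_measurable_def
    by (intro exI[of _ "\<lambda>n s. u n s + v n s"])
       (auto intro!: simple_function_compose2[where h = "(+)"] tendsto_add u v)
qed

lemma strongly_measurable_compose:
  assumes "strongly_measurable M f" "continuous_on UNIV h"
  shows "strongly_measurable M (\<lambda>s. h (f s))"
proof -
  obtain u where u: "\<And>n. simple_function M (u n)" "\<And>s. s \<in> space M \<Longrightarrow> (\<lambda>n. u n s) \<longlonglongrightarrow> f s"
    using assms(1) by (auto simp: strongly_measurable_def)
  show ?thesis
    unfolding strongly_measurable_def
    by (intro exI[of _ "\<lambda>n s. h (u n s)"] conjI allI ballI)
       (auto intro!: simple_function_compose1[OF u(1)]
         continuous_on_tendsto_compose[OF assms(2)] u(2))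
qed

lemma L1_add:
  assumes "f \<in> L1 M" "g \<in> L1 M"
  shows "(\<lambda>s. f s + g s) \<in> L1 M"
proof -
  have m: "strongly_measurable M (\<lambda>s. f s + g s)"
    using assms by (auto simp: L1_def intro: strongly_measurable_add)
  have "integrable M (\<lambda>s. norm (f s) + norm (g s))"
    using assms by (auto simp: L1_def)
  then have "integrable M (\<lambda>s. norm (f s + g s))"
    by (rule Bochner_Integration.integrable_bound)
       (auto intro: borel_measurable_norm_strongly_measurable m norm_triangle_ineq)
  with m show ?thesis by (simp add: L1_def)
qed

lemma L1_scaleR:
  assumes "f \<in> L1 M"
  shows "(\<lambda>s. c *\<^sub>R f s) \<in> L1 M"
proof -
  have "strongly_measurable M (\<lambda>s. c *\<^sub>R f s)"
    using assms by (intro strongly_measurable_compose[where h = "\<lambda>x. c *\<^sub>R x"])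
      (auto simp: L1_def intro!: continuous_on_scaleR)
  with assms show ?thesis by (auto simp: L1_def)
qed

lemma L1_scaleC:
  fixes f :: "'s \<Rightarrow> 'x::complex_normed_vector"
  assumes "f \<in> L1 M"
  shows "(\<lambda>s. c *\<^sub>C f s) \<in> L1 M"
proof -
  have "bounded_linear (\<lambda>x::'x. c *\<^sub>C x)"
    by (rule bounded_linear_intro[where K = "cmod c"])
       (auto simp: scaleC_add_right scaleC_scaleR norm_scaleC mult.commute)
  then have "strongly_measurable M (\<lambda>s. c *\<^sub>C f s)"
    using assms by (intro strongly_measurable_compose[where h = "\<lambda>x. c *\<^sub>C x"])
      (auto simp: L1_def intro: linear_continuous_on)
  with assms show ?thesis by (auto simp: L1_def norm_scaleC)
qed

lemma zero_set_sets:
  assumes "strongly_measurable M f"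
  shows "zero_set M f \<in> sets M"
proof -
  note [measurable] = borel_measurable_norm_strongly_measurable[OF assms]
  have "zero_set M f = {s \<in> space M. norm (f s) = 0}"
    by (auto simp: zero_set_def)
  also have "\<dots> \<in> sets M" by measurable
  finally show ?thesis .
qed

section \<open>The one-sided derivative of the \<open>L1\<close> norm and its tangent bound\<close>

lemma L1_norm_quotient_tendsto:
  fixes f g :: "'s \<Rightarrow> 'x::real_normed_vector"
  assumes f: "f \<in> L1 M" and g: "g \<in> L1 M"
    and deriv: "\<And>s. s \<in> space M \<Longrightarrow> f s \<noteq> 0 \<Longrightarrow>
      ((\<lambda>t. norm (f s + t *\<^sub>R g s)) has_real_derivative \<phi> s) (at 0)"
  shows "set_integrable M (space M - zero_set M f) \<phi>"
    and "set_integrable M (zero_set M f) (\<lambda>s. norm (g s))"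
    and "(\<lambda>n. (L1_norm M (\<lambda>s. f s + (1 / real (Suc n)) *\<^sub>R g s) - L1_norm M f) / (1 / real (Suc n)))
      \<longlonglongrightarrow> (LINT s:space M - zero_set M f|M. \<phi> s) + (LINT s:zero_set M f|M. norm (g s))"
proof -
  define t where "t = (\<lambda>n. 1 / real (Suc n))"
  define Q where "Q = (\<lambda>n s. (norm (f s + t n *\<^sub>R g s) - norm (f s)) / t n)"
  define h where "h = (\<lambda>s. indicator (space M - zero_set M f) s * \<phi> s
    + indicator (zero_set M f) s * norm (g s))"
  have t_pos: "0 < t n" for n by (simp add: t_def)
  have t_lim: "filterlim t (at 0) sequentially"
    unfolding filterlim_at using t_pos LIMSEQ_inverse_real_of_nat by (auto simp: t_def inverse_eq_divide)
  have Z[measurable]: "zero_set M f \<in> sets M"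
    using f by (auto simp: L1_def intro: zero_set_sets)
  have ft: "(\<lambda>s. f s + t n *\<^sub>R g s) \<in> L1 M" for n
    by (intro L1_add L1_scaleR f g)
  have int: "integrable M (\<lambda>s. norm (f s))" "integrable M (\<lambda>s. norm (g s))"
      "integrable M (\<lambda>s. norm (f s + t n *\<^sub>R g s))" for n
    using f g ft by (auto simp: L1_def)
  have [measurable]: "(\<lambda>s. norm (f s)) \<in> borel_measurable M" "(\<lambda>s. norm (g s)) \<in> borel_measurable M"
      "(\<lambda>s. norm (f s + t n *\<^sub>R g s)) \<in> borel_measurable M" for n
    using int by auto
  have Q_meas[measurable]: "Q n \<in> borel_measurable M" for n
    unfolding Q_def by measurable
  have Q_lim: "(\<lambda>n. Q n s) \<longlonglongrightarrow> h s" if s: "s \<in> space M" for s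
  proof (cases "f s = 0")
    case True
    \<comment> \<open>Where \<open>f\<close> vanishes the quotient is constant because
      \<open>t n\<close> is positive; a negative step would give the opposite sign.\<close>
    then have "Q n s = norm (g s)" for n
      using t_pos[of n] by (simp add: Q_def)
    moreover have "h s = norm (g s)" using True s by (simp add: h_def zero_set_def)
    ultimately show ?thesis by simp
  next
    case False
    then have "h s = \<phi> s" using s by (simp add: h_def zero_set_def)
    moreover have "((\<lambda>t. (norm (f s + t *\<^sub>R g s) - norm (f s)) / t) \<longlongrightarrow> \<phi> s) (at 0)"
      using deriv[OF s False] by (simp add: has_field_derivative_iff)
    ultimately show ?thesis
      unfolding Q_def by (auto intro: filterlim_compose[OF _ t_lim])
  qed
  have Q_le: "norm (Q n s) \<le> norm (g s)" for n s
  proof -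
    have "\<bar>norm (f s + t n *\<^sub>R g s) - norm (f s)\<bar> \<le> t n * norm (g s)"
      using norm_triangle_ineq3[of "f s + t n *\<^sub>R g s" "f s"] t_pos[of n] by simp
    then show ?thesis
      using t_pos[of n] by (simp add: Q_def pos_divide_le_eq mult.commute)
  qed
  \<comment> \<open>Measurability of \<phi> is not assumed. It is obtained off the zero set from
    \<open>h\<close>, a pointwise limit of the measurable quotients.\<close>
  have h_meas: "h \<in> borel_measurable M"
    by (rule borel_measurable_LIMSEQ_real[OF Q_lim Q_meas])
  note dom = h_meas Q_meas int(2) AE_I2[OF Q_lim] AE_I2[OF Q_le]
  have h_int: "integrable M h"
    by (rule integrable_dominated_convergence[OF dom])
  have lim: "(\<lambda>n. integral\<^sup>L M (Q n)) \<longlonglongrightarrow> integral\<^sup>L M h"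
    by (rule integral_dominated_convergence[OF dom])
  show int_g: "set_integrable M (zero_set M f) (\<lambda>s. norm (g s))"
    unfolding set_integrable_def by (rule integrable_mult_indicator[OF Z int(2)])
  have "integrable M (\<lambda>s. indicator (space M - zero_set M f) s *\<^sub>R h s)"
    by (rule integrable_mult_indicator[OF _ h_int]) measurable
  moreover have "(\<lambda>s. indicator (space M - zero_set M f) s *\<^sub>R h s)
      = (\<lambda>s. indicator (space M - zero_set M f) s *\<^sub>R \<phi> s)"
    by (auto simp: h_def indicator_def)
  ultimately show int_\<phi>: "set_integrable M (space M - zero_set M f) \<phi>"
    by (simp add: set_integrable_def)
  have "integral\<^sup>L M h = (LINT s:space M - zero_set M f|M. \<phi> s) + (LINT s:zero_set M f|M. norm (g s))"
    using int_\<phi> int_g by (simp add: set_integrable_def set_lebesgue_integral_def h_def)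
  moreover have "integral\<^sup>L M (Q n) = (L1_norm M (\<lambda>s. f s + t n *\<^sub>R g s) - L1_norm M f) / t n" for n
    using int by (simp add: Q_def L1_norm_def)
  ultimately show "(\<lambda>n. (L1_norm M (\<lambda>s. f s + (1 / real (Suc n)) *\<^sub>R g s) - L1_norm M f)
      / (1 / real (Suc n))) \<longlonglongrightarrow>
      (LINT s:space M - zero_set M f|M. \<phi> s) + (LINT s:zero_set M f|M. norm (g s))"
    using lim by (simp only: t_def)
qed

text \<open>The pointwise tangent inequality is integrated over the complement of the zero set. On
  the zero set the integrand is exactly \<open>\<bar>t\<bar> * norm (g s)\<close>. The bound holds
  for every \<open>t\<close>, so the converse direction below needs no limit.\<close>

lemma L1_norm_above_tangent:
  fixes f g :: "'s \<Rightarrow> 'x::real_normed_vector"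
  assumes f: "f \<in> L1 M" and g: "g \<in> L1 M"
    and deriv: "\<And>s. s \<in> space M \<Longrightarrow> f s \<noteq> 0 \<Longrightarrow>
      ((\<lambda>t. norm (f s + t *\<^sub>R g s)) has_real_derivative \<phi> s) (at 0)"
  shows "L1_norm M f + t * (LINT s:space M - zero_set M f|M. \<phi> s)
      + \<bar>t\<bar> * (LINT s:zero_set M f|M. norm (g s)) \<le> L1_norm M (\<lambda>s. f s + t *\<^sub>R g s)"
proof -
  let ?h = "\<lambda>s. norm (f s) + t * (indicator (space M - zero_set M f) s * \<phi> s)
      + \<bar>t\<bar> * (indicator (zero_set M f) s * norm (g s))"
  note int = L1_norm_quotient_tendsto(1,2)[OF f g deriv]
  have ints: "integrable M (\<lambda>s. norm (f s))"
      "integrable M (\<lambda>s. indicator (space M - zero_set M f) s * \<phi> s)"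
      "integrable M (\<lambda>s. indicator (zero_set M f) s * norm (g s))"
    using f int by (auto simp: L1_def set_integrable_def)
  have "integral\<^sup>L M ?h \<le> integral\<^sup>L M (\<lambda>s. norm (f s + t *\<^sub>R g s))"
  proof (rule integral_mono)
    show "integrable M ?h" using ints by simp
    show "integrable M (\<lambda>s. norm (f s + t *\<^sub>R g s))"
      using L1_add[OF f L1_scaleR[OF g]] by (simp add: L1_def)
    show "?h s \<le> norm (f s + t *\<^sub>R g s)" if "s \<in> space M" for s
      using has_real_derivative_norm_line_above_tangent[OF deriv[OF that], of t] that
      by (cases "f s = 0") (simp_all add: zero_set_def)
  qed
  with ints show ?thesis
    by (simp add: L1_norm_def set_lebesgue_integral_def)
qed

section \<open>Characterizations of Birkhoff-James orthogonality\<close>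

text \<open>Leaving the pointwise derivative \<phi> abstract lets one criterion serve both cases:
  \<phi> becomes a support map in the real case and the real part of one in the complex
  case.\<close>

lemma BJ_orthogonal_real_iff:
  fixes f g :: "'s \<Rightarrow> 'x::real_normed_vector"
  assumes f: "f \<in> L1 M" and g: "g \<in> L1 M"
    and deriv: "\<And>s. s \<in> space M \<Longrightarrow> f s \<noteq> 0 \<Longrightarrow>
      ((\<lambda>t. norm (f s + t *\<^sub>R g s)) has_real_derivative \<phi> s) (at 0)"
  shows "BJ_orthogonal (\<lambda>(c::real) h s. c *\<^sub>R h s) (L1_norm M) f g \<longleftrightarrow>
    \<bar>LINT s:space M - zero_set M f|M. \<phi> s\<bar> \<le> (LINT s:zero_set M f|M. norm (g s))"
    (is "?L \<longleftrightarrow> \<bar>?A\<bar> \<le> ?B")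
proof
  assume ?L
  then have BJ: "L1_norm M f \<le> L1_norm M (\<lambda>s. f s + c *\<^sub>R g s)" for c
    by (simp add: BJ_orthogonal_def plus_fun_def)
  have "0 \<le> ?A + ?B"
    using L1_norm_quotient_tendsto(3)[OF f g deriv]
    by (rule LIMSEQ_le_const) (use BJ in auto)
  \<comment> \<open>Replacing \<open>g\<close> by \<open>- g\<close> flips the sign of \<phi> but
    not the integral over the zero set. Positive steps along \<open>- g\<close> are negative
    multiples of \<open>g\<close>, which orthogonality also covers.\<close>
  moreover have "0 \<le> - ?A + ?B"
  proof -
    have ng: "(\<lambda>s. - g s) \<in> L1 M" using L1_scaleR[OF g, of "-1"] by simp
    have "((\<lambda>t. norm (f s + t *\<^sub>R (- g s))) has_real_derivative - \<phi> s) (at 0)"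
      if "s \<in> space M" "f s \<noteq> 0" for s
    proof -
      have "((\<lambda>t. norm (f s + (- t) *\<^sub>R g s)) has_real_derivative \<phi> s * (- 1)) (at 0)"
        by (rule DERIV_chain2[where g = uminus])
           (use deriv[OF that] in \<open>auto intro!: derivative_eq_intros\<close>)
      then show ?thesis by simp
    qed
    from L1_norm_quotient_tendsto(3)[OF f ng this]
    have "0 \<le> (LINT s:space M - zero_set M f|M. - \<phi> s) + (LINT s:zero_set M f|M. norm (- g s))"
      by (rule LIMSEQ_le_const)
         (use BJ[of "- (1 / real (Suc n))" for n] in \<open>auto intro!: exI[of _ 0]\<close>)
    then show ?thesis by (simp add: set_lebesgue_integral_def)
  qed
  ultimately show "\<bar>?A\<bar> \<le> ?B" by simp
next
  assume AB: "\<bar>?A\<bar> \<le> ?B"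
  have "L1_norm M f \<le> L1_norm M (\<lambda>s. f s + c *\<^sub>R g s)" for c
  proof -
    have "\<bar>c * ?A\<bar> \<le> \<bar>c\<bar> * ?B" using AB by (simp add: abs_mult mult_left_mono)
    then show ?thesis
      using L1_norm_above_tangent[OF f g deriv, of c] by linarith
  qed
  then show ?L by (simp add: BJ_orthogonal_def plus_fun_def)
qed

lemma BJ_orthogonal_complex_iff_real:
  fixes f g :: "'s \<Rightarrow> 'x::complex_normed_vector"
  shows "BJ_orthogonal (\<lambda>(c::complex) h s. c *\<^sub>C h s) (L1_norm M) f g \<longleftrightarrow>
    (\<forall>\<alpha>. BJ_orthogonal (\<lambda>(c::real) h s. c *\<^sub>R h s) (L1_norm M) f (\<lambda>s. \<alpha> *\<^sub>C g s))"
proof -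
  have R: "c *\<^sub>R (\<alpha> *\<^sub>C x) = (of_real c * \<alpha>) *\<^sub>C x" for c \<alpha> and x :: 'x
    by (simp only: scaleC_of_real[symmetric] scaleC_scaleC)
  show ?thesis
    unfolding BJ_orthogonal_def R
  proof (intro iffI allI)
    assume "\<forall>\<alpha> c. L1_norm M (f + (\<lambda>s. (of_real c * \<alpha>) *\<^sub>C g s)) \<ge> L1_norm M f"
    \<comment> \<open>The real factor 1 suffices, since \<alpha> already ranges over all complex
      scalars.\<close>
    from this[rule_format, of 1] show "L1_norm M (f + (\<lambda>s. c *\<^sub>C g s)) \<ge> L1_norm M f" for c
      by simp
  qed blast
qed

theorem corollary3p5:
  fixes M :: "'s measure"
  shows
    "(csmooth TYPE('x::complex_banach) \<longrightarrow>
       (\<forall>f\<in>L1 M. \<forall>g\<in>L1 M.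
          BJ_orthogonal (\<lambda>c (h :: 's \<Rightarrow> 'x) s. c *\<^sub>C h s) (L1_norm M) f g \<longleftrightarrow>
          (\<forall>\<alpha>::complex.
             \<bar>LINT s:space M - zero_set M f|M. Re (csupport_map (f s) (\<alpha> *\<^sub>C g s))\<bar>
               \<le> (LINT s:zero_set M f|M. cmod \<alpha> * norm (g s)))))
     \<and>
     (Frechet_norm TYPE('y::banach) \<longrightarrow>
       (\<forall>f\<in>L1 M. \<forall>g\<in>L1 M.
          BJ_orthogonal (\<lambda>(c::real) (h :: 's \<Rightarrow> 'y) s. c *\<^sub>R h s) (L1_norm M) f g \<longleftrightarrow>
          \<bar>LINT s:space M - zero_set M f|M. support_map (f s) (g s)\<bar>
            \<le> (LINT s:zero_set M f|M. norm (g s))))"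
proof (intro conjI impI ballI)
  fix f g :: "'s \<Rightarrow> 'x"
  assume smooth: "csmooth TYPE('x)" and f: "f \<in> L1 M" and g: "g \<in> L1 M"
  have "BJ_orthogonal (\<lambda>(c::real) h s. c *\<^sub>R h s) (L1_norm M) f (\<lambda>s. \<alpha> *\<^sub>C g s) \<longleftrightarrow>
      \<bar>LINT s:space M - zero_set M f|M. Re (csupport_map (f s) (\<alpha> *\<^sub>C g s))\<bar>
        \<le> (LINT s:zero_set M f|M. norm (\<alpha> *\<^sub>C g s))" for \<alpha>
    by (intro BJ_orthogonal_real_iff f L1_scaleC g csmooth_imp_csupport_map smooth)
  then show "BJ_orthogonal (\<lambda>c h s. c *\<^sub>C h s) (L1_norm M) f g \<longleftrightarrow>
      (\<forall>\<alpha>. \<bar>LINT s:space M - zero_set M f|M. Re (csupport_map (f s) (\<alpha> *\<^sub>C g s))\<bar>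
        \<le> (LINT s:zero_set M f|M. cmod \<alpha> * norm (g s)))"
    by (simp only: BJ_orthogonal_complex_iff_real norm_scaleC)
next
  fix f g :: "'s \<Rightarrow> 'y"
  assume "Frechet_norm TYPE('y)" "f \<in> L1 M" "g \<in> L1 M"
  then show "BJ_orthogonal (\<lambda>(c::real) h s. c *\<^sub>R h s) (L1_norm M) f g \<longleftrightarrow>
      \<bar>LINT s:space M - zero_set M f|M. support_map (f s) (g s)\<bar>
        \<le> (LINT s:zero_set M f|M. norm (g s))"
    by (intro BJ_orthogonal_real_iff norm_differentiable_imp_support_map)
       (auto simp: Frechet_norm_def)
qed

end
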